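(* Let $k$ be a field and $A=k[[t^5,t^{11}]] \subseteq V = k[[t]]$. Let $I$ be an Ulrich ideal of $A$, and let $f,g\in I$ be elements satisfying the conditions (i)-(v) listed in the context, with $a = \mathrm{o}(f)$ and $b=\mathrm{o}(g)$. (1) If $(a,b)=(10,27)$, then $$I=(t^{10} +\alpha_1 t^{11}+\alpha_2 t^{16} +\alpha_3 t^{22},\ t^{27})$$ for some $\alpha_1,\alpha_2,\alpha_3 \in k$ such that $\alpha_1 \ne 0$. (2) If $(a,b)= (20,26)$, then $$I=(t^{20} +\alpha_1t^{21}+\alpha_2 t^{22} +\alpha_3 t^{27}+\alpha_4 t^{33},\ t^{26} +\beta_1 t^{27} + \beta_2t^{33})$$ and $t^{32} + \varepsilon t^{33} \in I$ for some $\alpha_1,\alpha_2,\alpha_3,\alpha_4, \beta_1,\beta_2, \varepsilon \in k$.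
   Context: $A$ is the semigroup ring of the numerical semigroup $H=\langle 5,11\rangle$, i.e. the subring of $V=k[[t]]$ of power series whose exponents lie in $H$; $\mathrm{o}(\cdot)$ denotes the order (the $t$-adic valuation) on $V$. Ulrich ideal: let $(A,\mathfrak m)$ be a Cohen-Macaulay local ring of dimension one and $I$ an $\mathfrak m$-primary ideal containing a parameter ideal $Q=(x)$ as a reduction. $I$ is an Ulrich ideal of $A$ if (1) $I \neq Q$ and $I^2=QI$, and (2) $I/I^2$ is a free $A/I$-module. Since $A$ is Gorenstein, every Ulrich ideal $I$ of $A$ is minimally generated by two elements. Let $c=40$ be the conductor of $H$ and $\mathfrak c = A:V = t^{40}V$. The conditions on $f,g\in I$, with $a=\mathrm{o}(f)$, $b=\mathrm{o}(g)$, are: (i) $I=(f,g)$ and $I^2=fI$; (ii) $a,b\in H$ and $0<a<b<a+c$; (iii) $b-a\notin H$, $2b-a\in H$, and $a=2\,\ell_A(A/I)$, where $\ell_A$ denotes length; (iv) $t^{c-(b-a)}V\cap A\subseteq I$ and $\mathfrak c\subseteq I$; (v) if $a\ge c$, then the multiplicity of $A$ is $2$ and $I=\mathfrak c$. *)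

theory Defs
  imports
    "HOL-Computational_Algebra.Formal_Power_Series"
    "HOL-Library.Extended_Nat"
    "HOL-Algebra.Module"
    "HOL-Algebra.Ring_Divisibility"
    "HOL-Algebra.QuotRing"
    "HOL-Algebra.Ideal_Product"
begin

section \<open>Ideals and modules\<close>

definition radical :: "('a, 'b) ring_scheme \<Rightarrow> 'a set \<Rightarrow> 'a set" where
  "radical R I = {a \<in> carrier R. \<exists>n::nat. a [^]\<^bsub>R\<^esub> n \<in> I}"

definition primary_ideal :: "('a, 'b) ring_scheme \<Rightarrow> 'a set \<Rightarrow> bool" where
  "primary_ideal R I \<longleftrightarrow> ideal I R \<and> I \<noteq> carrier R \<and>
     (\<forall>a\<in>carrier R. \<forall>b\<in>carrier R. a \<otimes>\<^bsub>R\<^esub> b \<in> I \<longrightarrow> a \<in> I \<or> b \<in> radical R I)"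

definition primary_to :: "('a, 'b) ring_scheme \<Rightarrow> 'a set \<Rightarrow> 'a set \<Rightarrow> bool" where
  "primary_to R m I \<longleftrightarrow> primary_ideal R I \<and> radical R I = m"

definition krull_dim :: "('a, 'b) ring_scheme \<Rightarrow> enat" where
  "krull_dim R = Sup {enat n | n P.
     (\<forall>i\<le>n. primeideal (P i) R) \<and> (\<forall>i<n. P i \<subset> P (Suc i))}"

definition module_length :: "('a, 'c) ring_scheme \<Rightarrow> ('a, 'b, 'd) module_scheme \<Rightarrow> enat" where
  "module_length R M = Sup {enat n | n N.
     (\<forall>i\<le>n. submodule (N i) R M) \<and> (\<forall>i<n. N i \<subset> N (Suc i))}"

definition module_basis :: "('a, 'c) ring_scheme \<Rightarrow> ('a, 'b, 'd) module_scheme \<Rightarrow> 'b set \<Rightarrow> bool" where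
  "module_basis R M B \<longleftrightarrow> B \<subseteq> carrier M \<and>
     (\<forall>x\<in>carrier M. \<exists>!c. (\<forall>b. c b \<in> carrier R) \<and> (\<forall>b. b \<notin> B \<longrightarrow> c b = \<zero>\<^bsub>R\<^esub>) \<and>
        finite {b. c b \<noteq> \<zero>\<^bsub>R\<^esub>} \<and>
        x = (\<Oplus>\<^bsub>M\<^esub>b\<in>{b. c b \<noteq> \<zero>\<^bsub>R\<^esub>}. c b \<odot>\<^bsub>M\<^esub> b))"

definition free_module :: "('a, 'c) ring_scheme \<Rightarrow> ('a, 'b, 'd) module_scheme \<Rightarrow> bool" where
  "free_module R M \<longleftrightarrow> module R M \<and> (\<exists>B. module_basis R M B)"

text \<open>The residue ring $R/I$ regarded as an $R$-module.\<close>

definition residue_module :: "('a, 'b) ring_scheme \<Rightarrow> 'a set \<Rightarrow> ('a, 'a set) module" where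
  "residue_module R I =
     \<lparr>carrier = a_rcosets\<^bsub>R\<^esub> I, mult = rcoset_mult R I, one = I +>\<^bsub>R\<^esub> \<one>\<^bsub>R\<^esub>,
      zero = I, add = set_add R, smult = (\<lambda>a Y. \<Union>y\<in>Y. I +>\<^bsub>R\<^esub> (a \<otimes>\<^bsub>R\<^esub> y))\<rparr>"

text \<open>$I/I^2$ as a module over $R/I$, with $(a + I)(x + I^2) = ax + I^2$.
  The record type forces a multiplication and a unit to be given; they play no role
  for the module structure.\<close>

definition conormal_module :: "('a, 'b) ring_scheme \<Rightarrow> 'a set \<Rightarrow> ('a set, 'a set) module" where
  "conormal_module R I = (let J = ideal_prod R I I in
     \<lparr>carrier = (\<lambda>x. J +>\<^bsub>R\<^esub> x) ` I, mult = rcoset_mult R J, one = J +>\<^bsub>R\<^esub> \<one>\<^bsub>R\<^esub>,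
      zero = J, add = set_add R, smult = rcoset_mult R J\<rparr>)"


section \<open>Ulrich ideals\<close>

locale local_ring = cring R + maximalideal m R for R (structure) and m +
  assumes maximal_unique: "maximalideal J R \<Longrightarrow> J = m"

text \<open>In dimension one the Cohen-Macaulay condition asks for a regular sequence of
  length one in the maximal ideal.\<close>

definition cm_local_ring_dim1 :: "('a, 'b) ring_scheme \<Rightarrow> 'a set \<Rightarrow> bool" where
  "cm_local_ring_dim1 R m \<longleftrightarrow> local_ring R m \<and> noetherian_ring R \<and> krull_dim R = 1 \<and>
     (\<exists>x\<in>m. \<forall>y\<in>carrier R. x \<otimes>\<^bsub>R\<^esub> y = \<zero>\<^bsub>R\<^esub> \<longrightarrow> y = \<zero>\<^bsub>R\<^esub>)"

text \<open>Ideals generated by a system of parameters, which has length one in dimension one.\<close>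

definition parameter_ideal_dim1 :: "('a, 'b) ring_scheme \<Rightarrow> 'a set \<Rightarrow> 'a set \<Rightarrow> bool" where
  "parameter_ideal_dim1 R m Q \<longleftrightarrow> (\<exists>x\<in>m. Q = PIdl\<^bsub>R\<^esub> x \<and> primary_to R m Q)"

definition is_reduction :: "('a, 'b) ring_scheme \<Rightarrow> 'a set \<Rightarrow> 'a set \<Rightarrow> bool" where
  "is_reduction R Q I \<longleftrightarrow> Q \<subseteq> I \<and>
     (\<exists>n::nat. I [^]\<^bsub>ideals_set R\<^esub> Suc n = ideal_prod R Q (I [^]\<^bsub>ideals_set R\<^esub> n))"

definition ulrich_ideal :: "('a, 'b) ring_scheme \<Rightarrow> 'a set \<Rightarrow> 'a set \<Rightarrow> bool" where
  "ulrich_ideal R m I \<longleftrightarrow> cm_local_ring_dim1 R m \<and> primary_to R m I \<and>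
     (\<exists>Q. parameter_ideal_dim1 R m Q \<and> is_reduction R Q I \<and>
        I \<noteq> Q \<and> ideal_prod R I I = ideal_prod R Q I \<and>
        free_module (R Quot I) (conormal_module R I))"

text \<open>The Hilbert--Samuel multiplicity $\lim_n d!\,\ell(R/m^n)/n^d$ for $d = 1$.\<close>

definition multiplicity_dim1 :: "('a, 'b) ring_scheme \<Rightarrow> 'a set \<Rightarrow> real" where
  "multiplicity_dim1 R m =
     lim (\<lambda>n. real (the_enat (module_length R (residue_module R (m [^]\<^bsub>ideals_set R\<^esub> n)))) / real n)"


section \<open>Semigroup rings\<close>

definition semigroup_ring :: "nat set \<Rightarrow> 'k::field fps ring" where
  "semigroup_ring H = \<lparr>carrier = {f. \<forall>n. fps_nth f n \<noteq> 0 \<longrightarrow> n \<in> H},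
     mult = (*), one = 1, zero = 0, add = (+)\<rparr>"

definition semigroup_max_ideal :: "nat set \<Rightarrow> 'k::field fps set" where
  "semigroup_max_ideal H = {f \<in> carrier (semigroup_ring H). fps_nth f 0 = 0}"

definition conductor :: "nat set \<Rightarrow> nat" where
  "conductor H = (LEAST c. \<forall>n\<ge>c. n \<in> H)"

text \<open>The colon $A : V$ for $A = k[[H]]$ and $V = k[[t]]$.\<close>

definition conductor_ideal :: "nat set \<Rightarrow> 'k::field fps set" where
  "conductor_ideal H = {f. \<forall>v. f * v \<in> carrier (semigroup_ring H)}"

definition H511 :: "nat set" where
  "H511 = {5 * i + 11 * j | i j. True}"

abbreviation A511 :: "'k::field fps ring" where
  "A511 \<equiv> semigroup_ring H511"

abbreviation m511 :: "'k::field fps set" where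
  "m511 \<equiv> semigroup_max_ideal H511"

text \<open>\<open>t_power_ideal n\<close> is $t^n V$.\<close>

definition t_power_ideal :: "nat \<Rightarrow> 'k::field fps set" where
  "t_power_ideal n = range (\<lambda>v. fps_X ^ n * v)"


section \<open>Basic facts\<close>

lemma residue_module:
  assumes "cring R" "ideal I R"
  shows "module R (residue_module R I)"
proof -
  interpret R: cring R by fact
  interpret I: ideal I R by fact
  let ?M = "residue_module R I"
  have car: "carrier ?M = (\<lambda>x. I +>\<^bsub>R\<^esub> x) ` carrier R"
    by (auto simp: residue_module_def A_RCOSETS_def' a_r_coset_def)
  have add: "(I +>\<^bsub>R\<^esub> x) \<oplus>\<^bsub>?M\<^esub> (I +>\<^bsub>R\<^esub> y) = I +>\<^bsub>R\<^esub> (x \<oplus>\<^bsub>R\<^esub> y)"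
    if "x \<in> carrier R" "y \<in> carrier R" for x y
    using that by (simp add: residue_module_def I.a_rcos_sum)
  have sm: "a \<odot>\<^bsub>?M\<^esub> (I +>\<^bsub>R\<^esub> x) = I +>\<^bsub>R\<^esub> (a \<otimes>\<^bsub>R\<^esub> x)"
    if a: "a \<in> carrier R" and x: "x \<in> carrier R" for a x
  proof -
    have "I +>\<^bsub>R\<^esub> (a \<otimes>\<^bsub>R\<^esub> y) = I +>\<^bsub>R\<^esub> (a \<otimes>\<^bsub>R\<^esub> x)" if y: "y \<in> I +>\<^bsub>R\<^esub> x" for y
    proof -
      obtain i where i: "i \<in> I" "y = i \<oplus>\<^bsub>R\<^esub> x" using y by (auto simp: a_r_coset_def')
      have "a \<otimes>\<^bsub>R\<^esub> y = a \<otimes>\<^bsub>R\<^esub> i \<oplus>\<^bsub>R\<^esub> a \<otimes>\<^bsub>R\<^esub> x"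
        using a x i by (simp add: R.r_distr I.Icarr)
      moreover have "a \<otimes>\<^bsub>R\<^esub> i \<in> I" using a i by (simp add: I.I_l_closed)
      ultimately have "a \<otimes>\<^bsub>R\<^esub> y \<in> I +>\<^bsub>R\<^esub> (a \<otimes>\<^bsub>R\<^esub> x)" by (auto simp: a_r_coset_def')
      then show ?thesis using I.a_repr_independence'[of "a \<otimes>\<^bsub>R\<^esub> y"] a x by simp
    qed
    moreover have "x \<in> I +>\<^bsub>R\<^esub> x" using x I.a_rcos_self by simp
    ultimately have "(\<Union>y\<in>I +>\<^bsub>R\<^esub> x. I +>\<^bsub>R\<^esub> (a \<otimes>\<^bsub>R\<^esub> y)) = I +>\<^bsub>R\<^esub> (a \<otimes>\<^bsub>R\<^esub> x)"
      by blast
    then show ?thesis by (simp add: residue_module_def)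
  qed
  have zero: "\<zero>\<^bsub>?M\<^esub> = I +>\<^bsub>R\<^esub> \<zero>\<^bsub>R\<^esub>"
    by (simp add: residue_module_def R.a_coset_add_zero I.a_subset)
  have "abelian_group ?M"
  proof (rule abelian_groupI)
    fix X assume "X \<in> carrier ?M"
    then obtain x where "x \<in> carrier R" "X = I +>\<^bsub>R\<^esub> x" by (auto simp: car)
    then show "\<exists>Y\<in>carrier ?M. Y \<oplus>\<^bsub>?M\<^esub> X = \<zero>\<^bsub>?M\<^esub>"
      by (intro bexI[of _ "I +>\<^bsub>R\<^esub> (\<ominus>\<^bsub>R\<^esub> x)"]) (auto simp: car add zero R.l_neg)
  qed (auto simp: car add zero R.a_ac)
  then show ?thesis
    by (rule moduleI[OF R.cring_axioms])
      (auto simp: car add sm R.l_distr R.r_distr R.m_assoc)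
qed

lemma conormal_module:
  assumes "cring R" "ideal I R"
  shows "module (R Quot I) (conormal_module R I)"
proof -
  interpret R: cring R by fact
  interpret I: ideal I R by fact
  define J where "J = ideal_prod R I I"
  interpret J: ideal J R unfolding J_def by (rule R.ideal_prod_is_ideal) fact+
  let ?M = "conormal_module R I"
  have JI: "J \<subseteq> I" unfolding J_def
    using R.ideal_prod_inter[of I I] I.ideal_axioms by blast
  have car: "carrier ?M = (\<lambda>x. J +>\<^bsub>R\<^esub> x) ` I" and zero: "\<zero>\<^bsub>?M\<^esub> = J +>\<^bsub>R\<^esub> \<zero>\<^bsub>R\<^esub>"
    by (simp_all add: conormal_module_def Let_def J_def[symmetric] R.a_coset_add_zero J.a_subset)
  have carQ: "carrier (R Quot I) = (\<lambda>x. I +>\<^bsub>R\<^esub> x) ` carrier R"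
    by (auto simp: FactRing_def A_RCOSETS_def' a_r_coset_def)
  have Q1: "\<one>\<^bsub>R Quot I\<^esub> = I +>\<^bsub>R\<^esub> \<one>\<^bsub>R\<^esub>" by (simp add: FactRing_def)
  have Qadd: "(I +>\<^bsub>R\<^esub> x) \<oplus>\<^bsub>R Quot I\<^esub> (I +>\<^bsub>R\<^esub> y) = I +>\<^bsub>R\<^esub> (x \<oplus>\<^bsub>R\<^esub> y)"
   and Qmult: "(I +>\<^bsub>R\<^esub> x) \<otimes>\<^bsub>R Quot I\<^esub> (I +>\<^bsub>R\<^esub> y) = I +>\<^bsub>R\<^esub> (x \<otimes>\<^bsub>R\<^esub> y)"
    if "x \<in> carrier R" "y \<in> carrier R" for x y
    using that by (simp_all add: FactRing_def I.a_rcos_sum I.rcoset_mult_add)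
  have add: "(J +>\<^bsub>R\<^esub> x) \<oplus>\<^bsub>?M\<^esub> (J +>\<^bsub>R\<^esub> y) = J +>\<^bsub>R\<^esub> (x \<oplus>\<^bsub>R\<^esub> y)"
    if "x \<in> carrier R" "y \<in> carrier R" for x y
    using that by (simp add: conormal_module_def Let_def J_def[symmetric] J.a_rcos_sum)
  have sm: "(I +>\<^bsub>R\<^esub> a) \<odot>\<^bsub>?M\<^esub> (J +>\<^bsub>R\<^esub> x) = J +>\<^bsub>R\<^esub> (a \<otimes>\<^bsub>R\<^esub> x)"
    if a: "a \<in> carrier R" and x: "x \<in> I" for a x
  proof -
    have xc: "x \<in> carrier R" using x by (rule I.Icarr)
    have "J +>\<^bsub>R\<^esub> (b \<otimes>\<^bsub>R\<^esub> y) = J +>\<^bsub>R\<^esub> (a \<otimes>\<^bsub>R\<^esub> x)"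
      if b: "b \<in> I +>\<^bsub>R\<^esub> a" and y: "y \<in> J +>\<^bsub>R\<^esub> x" for b y
    proof -
      obtain i where i: "i \<in> I" "b = i \<oplus>\<^bsub>R\<^esub> a" using b by (auto simp: a_r_coset_def')
      obtain j where j: "j \<in> J" "y = j \<oplus>\<^bsub>R\<^esub> x" using y by (auto simp: a_r_coset_def')
      have ic: "i \<in> carrier R" and jc: "j \<in> carrier R"
        using i j by (simp_all add: I.Icarr J.Icarr)
      have "b \<otimes>\<^bsub>R\<^esub> y = (b \<otimes>\<^bsub>R\<^esub> j \<oplus>\<^bsub>R\<^esub> i \<otimes>\<^bsub>R\<^esub> x) \<oplus>\<^bsub>R\<^esub> a \<otimes>\<^bsub>R\<^esub> x"
        using a xc ic jc i j by (simp add: R.r_distr R.l_distr R.a_assoc)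
      moreover have "b \<otimes>\<^bsub>R\<^esub> j \<in> J" using i ic a j by (simp add: J.I_l_closed)
      moreover have "i \<otimes>\<^bsub>R\<^esub> x \<in> J" unfolding J_def using i x by (auto intro: ideal_prod.prod)
      ultimately have "b \<otimes>\<^bsub>R\<^esub> y \<in> J +>\<^bsub>R\<^esub> (a \<otimes>\<^bsub>R\<^esub> x)"
        by (auto simp: a_r_coset_def')
      then show ?thesis using J.a_repr_independence'[of "b \<otimes>\<^bsub>R\<^esub> y"] a xc by simp
    qed
    moreover have "x \<in> J +>\<^bsub>R\<^esub> x" "a \<in> I +>\<^bsub>R\<^esub> a"
      using xc a J.a_rcos_self I.a_rcos_self by simp_all
    ultimately have "(\<Union>b\<in>I +>\<^bsub>R\<^esub> a. \<Union>y\<in>J +>\<^bsub>R\<^esub> x. J +>\<^bsub>R\<^esub> (b \<otimes>\<^bsub>R\<^esub> y))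
        = J +>\<^bsub>R\<^esub> (a \<otimes>\<^bsub>R\<^esub> x)"
      by blast
    then show ?thesis
      by (simp add: conormal_module_def Let_def J_def[symmetric] rcoset_mult_def)
  qed
  have "abelian_group ?M"
  proof (rule abelian_groupI)
    fix X assume "X \<in> carrier ?M"
    then obtain x where x: "x \<in> I" "X = J +>\<^bsub>R\<^esub> x" by (auto simp: car)
    then show "\<exists>Y\<in>carrier ?M. Y \<oplus>\<^bsub>?M\<^esub> X = \<zero>\<^bsub>?M\<^esub>"
      by (intro bexI[of _ "J +>\<^bsub>R\<^esub> (\<ominus>\<^bsub>R\<^esub> x)"])
        (auto simp: car add zero I.Icarr R.l_neg)
  qed (auto simp: car add zero I.Icarr R.a_ac)
  then show ?thesis
    by (rule moduleI[OF I.quotient_is_cring[OF R.cring_axioms]])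
      (auto simp: car carQ Q1 Qadd Qmult add sm I.Icarr I.I_l_closed R.l_distr R.r_distr R.m_assoc)
qed

text \<open>The ring $k[[H]]$ of a numerical semigroup $H$ is a one-dimensional
  Cohen-Macaulay local ring, so the ambient requirement in \<open>ulrich_ideal\<close>
  is satisfied by \<open>A511\<close>.\<close>

locale numerical_semigroup =
  fixes H :: "nat set" and c :: nat
  assumes zero_mem: "0 \<in> H"
    and add_mem: "i \<in> H \<Longrightarrow> j \<in> H \<Longrightarrow> i + j \<in> H"
    and ge_mem: "n \<ge> c \<Longrightarrow> n \<in> H"
begin

lemma mem_carrier: "f \<in> carrier (semigroup_ring H) \<longleftrightarrow> (\<forall>n. fps_nth f n \<noteq> 0 \<longrightarrow> n \<in> H)"
  by (simp add: semigroup_ring_def)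

lemma ops [simp]:
  "mult (semigroup_ring H) = (*)" "one (semigroup_ring H) = 1"
  "zero (semigroup_ring H) = 0" "add (semigroup_ring H) = (+)"
  by (simp_all add: semigroup_ring_def)

lemma carrier_mult:
  assumes "f \<in> carrier (semigroup_ring H)" "g \<in> carrier (semigroup_ring H)"
  shows "f * g \<in> carrier (semigroup_ring H)"
  unfolding mem_carrier
proof (intro allI impI)
  fix n assume "fps_nth (f * g) n \<noteq> 0"
  then obtain i where "i \<le> n" "fps_nth f i * fps_nth g (n - i) \<noteq> 0"
    unfolding fps_mult_nth by (metis (no_types, lifting) atLeastAtMost_iff sum.neutral)
  then show "n \<in> H" using add_mem[of i "n - i"] assms unfolding mem_carrier by auto
qed

lemma carrier_misc:
  "0 \<in> carrier (semigroup_ring H)" "1 \<in> carrier (semigroup_ring H)"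
  "fps_const x \<in> carrier (semigroup_ring H)"
  "f \<in> carrier (semigroup_ring H) \<Longrightarrow> - f \<in> carrier (semigroup_ring H)"
  "f \<in> carrier (semigroup_ring H) \<Longrightarrow> g \<in> carrier (semigroup_ring H) \<Longrightarrow> f + g \<in> carrier (semigroup_ring H)"
  "f \<in> carrier (semigroup_ring H) \<Longrightarrow> g \<in> carrier (semigroup_ring H) \<Longrightarrow> f - g \<in> carrier (semigroup_ring H)"
  using zero_mem by (auto simp: mem_carrier split: if_splits) (metis add.right_neutral diff_zero)+

lemma subdegree_ge_carrier:
  assumes "\<And>i. i < c \<Longrightarrow> fps_nth f i = 0"
  shows "f \<in> carrier (semigroup_ring H)"
  unfolding mem_carrier using assms ge_mem by (meson not_le)

lemma cring: "cring (semigroup_ring H)"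
proof (rule cringI)
  show "abelian_group (semigroup_ring H)"
  proof (rule abelian_groupI)
    fix x assume "x \<in> carrier (semigroup_ring H)"
    then show "\<exists>y\<in>carrier (semigroup_ring H). y \<oplus>\<^bsub>semigroup_ring H\<^esub> x = \<zero>\<^bsub>semigroup_ring H\<^esub>"
      by (intro bexI[of _ "- x"]) (auto simp: carrier_misc)
  qed (simp_all add: carrier_misc add_ac)
  show "comm_monoid (semigroup_ring H)"
    by (rule comm_monoidI) (auto simp: carrier_misc carrier_mult mult_ac)
qed (simp add: distrib_right)

lemma domain: "domain (semigroup_ring H)"
  using cring by (intro domain.intro domain_axioms.intro) auto

lemma carrier_inverse:
  assumes f: "f \<in> carrier (semigroup_ring H)" and f0: "fps_nth f 0 \<noteq> 0"
  shows "inverse f \<in> carrier (semigroup_ring H)"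
proof -
  have "fps_nth (inverse f) n \<noteq> 0 \<longrightarrow> n \<in> H" for n
  proof (induction n rule: less_induct)
    case (less n)
    show ?case
    proof (cases "n = 0")
      case False
      show ?thesis
      proof (rule impI, rule ccontr)
        assume nz: "fps_nth (inverse f) n \<noteq> 0" and nH: "n \<notin> H"
        have "0 = fps_nth (f * inverse f) n"
          using inverse_mult_eq_1'[OF f0] False by simp
        also have "\<dots> = (\<Sum>i=0..n. fps_nth f i * fps_nth (inverse f) (n - i))"
          by (simp add: fps_mult_nth)
        also have "\<dots> = fps_nth f 0 * fps_nth (inverse f) n
            + (\<Sum>i=1..n. fps_nth f i * fps_nth (inverse f) (n - i))"
          by (simp add: sum.atLeast_Suc_atMost)
        also have "(\<Sum>i=1..n. fps_nth f i * fps_nth (inverse f) (n - i)) = 0"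
        proof (rule sum.neutral, rule ballI, rule ccontr)
          fix i assume i: "i \<in> {1..n}" and "fps_nth f i * fps_nth (inverse f) (n - i) \<noteq> 0"
          then have "i \<in> H" "n - i \<in> H" using f less[of "n - i"] unfolding mem_carrier by auto
          then show False using add_mem[of i "n - i"] nH i by auto
        qed
        finally show False using nz f0 by simp
      qed
    qed (use zero_mem in simp)
  qed
  then show ?thesis by (simp add: mem_carrier)
qed

lemma max_ideal_ideal: "ideal (semigroup_max_ideal H) (semigroup_ring H :: 'a::field fps ring)"
proof -
  interpret R: cring "semigroup_ring H :: 'a fps ring" by (rule cring)
  have inv: "\<ominus>\<^bsub>semigroup_ring H\<^esub> x = - x" if "x \<in> carrier (semigroup_ring H)" for x :: "'a fps"
    using R.minus_equality[of "- x" x] that carrier_misc(4)[OF that] by simp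
  show ?thesis
  proof (rule idealI[OF R.ring_axioms])
    show "subgroup (semigroup_max_ideal H) (add_monoid (semigroup_ring H :: 'a fps ring))"
    proof (rule group.subgroupI[OF R.a_group])
      fix a :: "'a fps" assume "a \<in> semigroup_max_ideal H"
      then show "inv\<^bsub>add_monoid (semigroup_ring H)\<^esub> a \<in> semigroup_max_ideal H"
        using inv[of a] carrier_misc(4)[of a]
        unfolding a_inv_def by (simp add: semigroup_max_ideal_def del: ops)
    next
      show "semigroup_max_ideal H \<noteq> ({} :: 'a fps set)"
        using carrier_misc(1) by (auto simp: semigroup_max_ideal_def)
    qed (auto simp: semigroup_max_ideal_def carrier_misc)
  qed (auto simp: semigroup_max_ideal_def carrier_mult)
qed

lemma proper_ideal_le:
  assumes "ideal J (semigroup_ring H)" "J \<noteq> carrier (semigroup_ring H)"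
  shows "J \<subseteq> semigroup_max_ideal H"
proof
  interpret ideal J "semigroup_ring H" by fact
  fix f assume f: "f \<in> J"
  have fc: "f \<in> carrier (semigroup_ring H)" using f by (rule Icarr)
  have "fps_nth f 0 = 0"
  proof (rule ccontr)
    assume f0: "fps_nth f 0 \<noteq> 0"
    have "f * inverse f \<in> J" using I_r_closed[OF f carrier_inverse[OF fc f0]] by simp
    then have "1 \<in> J" using inverse_mult_eq_1'[OF f0] by simp
    then show False using one_imp_carrier assms(2) by simp
  qed
  then show "f \<in> semigroup_max_ideal H" using fc by (simp add: semigroup_max_ideal_def)
qed

lemma max_ideal_proper: "semigroup_max_ideal H \<noteq> carrier (semigroup_ring H :: 'a::field fps ring)"
proof
  assume "semigroup_max_ideal H = carrier (semigroup_ring H :: 'a fps ring)"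
  then have "1 \<in> (semigroup_max_ideal H :: 'a fps set)" using carrier_misc(2) by simp
  then show False by (simp add: semigroup_max_ideal_def)
qed

lemma local_ring: "local_ring (semigroup_ring H) (semigroup_max_ideal H)"
proof -
  have mx: "maximalideal (semigroup_max_ideal H) (semigroup_ring H)"
    using max_ideal_ideal max_ideal_proper proper_ideal_le
    by (intro maximalidealI) blast+
  show ?thesis
  proof (intro local_ring.intro local_ring_axioms.intro cring mx)
    fix J :: "'a fps set" assume J: "maximalideal J (semigroup_ring H)"
    have "J \<subseteq> semigroup_max_ideal H"
      using J proper_ideal_le by (metis maximalideal.I_notcarr maximalideal.axioms(1))
    then show "J = semigroup_max_ideal H"
      using maximalideal.I_maximal[OF J max_ideal_ideal] max_ideal_proper
      by (auto simp: semigroup_max_ideal_def)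
  qed
qed

lemma ideal_contains_tail:
  assumes "ideal J (semigroup_ring H)" "f \<in> J" "f \<noteq> 0"
    and h: "\<And>i. i < subdegree f + c \<Longrightarrow> fps_nth h i = 0"
  shows "h \<in> J"
proof -
  interpret ideal J "semigroup_ring H" by fact
  define u where "u = unit_factor f"
  have u: "fps_nth u 0 \<noteq> 0" using assms(3) unfolding u_def by simp
  have fu: "f = u * fps_X ^ subdegree f" unfolding u_def by (simp add: subdegree_decompose)
  define h' where "h' = fps_shift (subdegree f) h"
  have hh: "h = h' * fps_X ^ subdegree f"
    unfolding h'_def
    by (rule fps_ext) (use h in \<open>auto simp: fps_X_power_mult_right_nth\<close>)
  have "inverse u * h' \<in> carrier (semigroup_ring H)"
  proof (rule subdegree_ge_carrier)
    fix i assume "i < c"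
    then have "fps_nth h' j = 0" if "j \<le> i" for j using that h unfolding h'_def by simp
    then show "fps_nth (inverse u * h') i = 0" by (simp add: fps_mult_nth)
  qed
  then have "f * (inverse u * h') \<in> J" using I_r_closed[OF assms(2)] by simp
  also have "f * (inverse u * h') = (u * inverse u) * (h' * fps_X ^ subdegree f)"
    by (subst fu) (simp only: mult_ac)
  also have "\<dots> = h" using inverse_mult_eq_1'[OF u] hh by simp
  finally show ?thesis .
qed

lemma noetherian_ring: "noetherian_ring (semigroup_ring H :: 'k::field fps ring)"
proof -
  interpret R: cring "semigroup_ring H :: 'k fps ring" by (rule cring)
  have "\<exists>S\<subseteq>carrier (semigroup_ring H). finite S \<and> J = Idl\<^bsub>semigroup_ring H\<^esub> S"
    if J: "ideal J (semigroup_ring H)" for J :: "'k fps set"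
  proof (cases "J \<subseteq> {0}")
    case True
    interpret J: ideal J "semigroup_ring H" by fact
    have "J = {0}" using True J.zero_closed by auto
    then show ?thesis using R.genideal_zero
      by (intro exI[of _ "{0}"]) (auto simp: carrier_misc)
  next
    case False
    interpret J: ideal J "semigroup_ring H" by fact
    from False obtain f where f: "f \<in> J" "f \<noteq> 0" by auto
    define N where "N = subdegree f + c"
    define s where "s d = (SOME g. g \<in> J \<and> g \<noteq> 0 \<and> subdegree g = d)" for d
    define D where "D = {d. d < N \<and> (\<exists>g. g \<in> J \<and> g \<noteq> 0 \<and> subdegree g = d)}"
    define S where "S = insert f (s ` D)"
    have s: "s d \<in> J \<and> s d \<noteq> 0 \<and> subdegree (s d) = d" if "d \<in> D" for d
      using that unfolding s_def D_def by (metis (mono_tags, lifting) mem_Collect_eq someI_ex)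
    have SJ: "S \<subseteq> J" using s f unfolding S_def by auto
    then have Sc: "S \<subseteq> carrier (semigroup_ring H)" using J.a_subset by simp
    have fin: "finite S" unfolding S_def D_def by simp
    let ?K = "Idl\<^bsub>semigroup_ring H\<^esub> S"
    interpret K: ideal ?K "semigroup_ring H" by (rule R.genideal_ideal[OF Sc])
    have SK: "S \<subseteq> ?K" by (rule R.genideal_self[OF Sc])
    have step: "\<forall>h\<in>J. (\<forall>i<j. fps_nth h i = 0) \<longrightarrow> h \<in> ?K" if "j \<le> N" for j
      using that
    proof (induction j rule: inc_induct)
      case base
      show ?case using ideal_contains_tail[OF K.ideal_axioms _ f(2)] SK
        unfolding N_def S_def by blast
    next
      case (step d)
      show ?case
      proof (intro ballI impI)
        fix h assume h: "h \<in> J" "\<forall>i<d. fps_nth h i = 0"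
        show "h \<in> ?K"
        proof (cases "fps_nth h d = 0")
          case True
          then show ?thesis using step.IH h by (metis less_Suc_eq)
        next
          case False
          then have sd: "subdegree h = d" using h(2) by (simp add: subdegreeI)
          have dD: "d \<in> D" using False sd h(1) step.hyps unfolding D_def
            by (auto intro!: exI[of _ h])
          define r where "r = fps_nth h d / fps_nth (s d) d"
          have sn: "fps_nth (s d) d \<noteq> 0" using s[OF dD] by (metis nth_subdegree_nonzero)
          have sl: "fps_nth (s d) i = 0" if "i < d" for i
            using s[OF dD] that by (metis nth_less_subdegree_zero)
          have 1: "fps_const r * s d \<in> ?K"
            using K.I_l_closed[of "s d" "fps_const r"] SK dD carrier_misc(3) unfolding S_def by auto
          have 2: "fps_const (- r) * s d \<in> J"
            using J.I_l_closed[of "s d" "fps_const (- r)"] s[OF dD] carrier_misc(3) by auto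
          have "h + fps_const (- r) * s d \<in> J" using J.a_closed[OF h(1) 2] by simp
          moreover have "\<forall>i<Suc d. fps_nth (h + fps_const (- r) * s d) i = 0"
            using h(2) sn sl by (auto simp: less_Suc_eq r_def)
          ultimately have "h + fps_const (- r) * s d \<in> ?K" using step.IH by blast
          from K.a_closed[OF this 1] show ?thesis
            by (simp add: add.assoc flip: distrib_right)
        qed
      qed
    qed
    have "J \<subseteq> ?K" using step[of 0] by auto
    moreover have "?K \<subseteq> J" by (rule R.genideal_minimal[OF J SJ])
    ultimately show ?thesis using Sc fin by blast
  qed
  then show ?thesis
    by (intro noetherian_ring.intro noetherian_ring_axioms.intro R.ring_axioms) blast
qed

lemma prime_cases:
  assumes P: "primeideal P (semigroup_ring H)"
  shows "P = {0} \<or> P = semigroup_max_ideal H"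
proof (rule disjCI)
  interpret P: primeideal P "semigroup_ring H" by fact
  assume "P \<noteq> semigroup_max_ideal H"
  moreover have "P \<subseteq> semigroup_max_ideal H"
    using proper_ideal_le[OF P.ideal_axioms] P.I_notcarr by auto
  ultimately obtain h where h: "h \<in> semigroup_max_ideal H" "h \<notin> P" by auto
  have hc: "h \<in> carrier (semigroup_ring H)" using h(1) by (simp add: semigroup_max_ideal_def)
  have pc: "h ^ n \<in> carrier (semigroup_ring H)" for n
    by (induction n) (auto simp: carrier_misc carrier_mult hc)
  have np: "h ^ n \<notin> P" for n
  proof (induction n)
    case 0
    then show ?case using P.one_imp_carrier P.I_notcarr by auto
  next
    case (Suc n)
    then show ?case using P.I_prime[OF hc pc] h(2) by auto
  qed
  show "P = {0}"
  proof (rule ccontr)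
    assume "P \<noteq> {0}"
    then obtain f where f: "f \<in> P" "f \<noteq> 0" using additive_subgroup.zero_closed[OF P.is_additive_subgroup] by auto
    have "h ^ (subdegree f + c) \<in> P"
    proof (rule ideal_contains_tail[OF P.ideal_axioms f])
      fix i assume "i < subdegree f + c"
      then show "fps_nth (h ^ (subdegree f + c)) i = 0"
        using startsby_zero_power_prefix[of h] h(1) by (auto simp: semigroup_max_ideal_def)
    qed
    then show False using np by blast
  qed
qed

lemma max_ideal_nonzero: "{0} \<subset> (semigroup_max_ideal H :: 'k::field fps set)"
proof -
  have "(fps_X ^ Suc c :: 'k fps) \<in> semigroup_max_ideal H"
    unfolding semigroup_max_ideal_def by (auto intro!: subdegree_ge_carrier)
  moreover have "(fps_X ^ Suc c :: 'k fps) \<noteq> 0" by simp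
  moreover have "(0 :: 'k fps) \<in> semigroup_max_ideal H"
    by (simp add: semigroup_max_ideal_def carrier_misc)
  ultimately show ?thesis by blast
qed

lemma krull_dim: "krull_dim (semigroup_ring H :: 'k::field fps ring) = 1"
proof -
  interpret R: domain "semigroup_ring H :: 'k fps ring" by (rule domain)
  interpret L: local_ring "semigroup_ring H :: 'k fps ring" "semigroup_max_ideal H"
    by (rule local_ring)
  have pz: "primeideal {0} (semigroup_ring H :: 'k fps ring)"
    using R.zeroprimeideal by simp
  have pm: "primeideal (semigroup_max_ideal H) (semigroup_ring H :: 'k fps ring)"
    by (rule R.maximalideal_prime) (rule L.is_maximalideal)
  have chain1: "\<exists>P. (\<forall>i\<le>1. primeideal (P i) (semigroup_ring H :: 'k fps ring))
      \<and> (\<forall>i<1::nat. P i \<subset> P (Suc i))"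
    using pz pm max_ideal_nonzero by (intro exI[of _ "\<lambda>i. if i = 0 then {0} else semigroup_max_ideal H"]) auto
  have bound: "n \<le> 1" if "\<forall>i\<le>n. primeideal (P i) (semigroup_ring H :: 'k fps ring)"
      "\<forall>i<n. P i \<subset> P (Suc i)" for n P
  proof (rule ccontr)
    assume "\<not> n \<le> 1"
    then have "P 0 \<subset> P 1" "P 1 \<subset> P 2" "primeideal (P 0) (semigroup_ring H :: 'k fps ring)"
      "primeideal (P 1) (semigroup_ring H :: 'k fps ring)"
      "primeideal (P 2) (semigroup_ring H :: 'k fps ring)"
      using that by (auto simp: numeral_2_eq_2)
    then show False using prime_cases by (metis psubset_eq subset_antisym)
  qed
  show ?thesis
    unfolding krull_dim_def
  proof (rule antisym)
    show "Sup {enat n | n P. (\<forall>i\<le>n. primeideal (P i) (semigroup_ring H :: 'k fps ring))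
        \<and> (\<forall>i<n. P i \<subset> P (Suc i))} \<le> 1"
      using bound by (intro Sup_least) (auto simp: one_enat_def)
    show "1 \<le> Sup {enat n | n P. (\<forall>i\<le>n. primeideal (P i) (semigroup_ring H :: 'k fps ring))
        \<and> (\<forall>i<n. P i \<subset> P (Suc i))}"
      using chain1 unfolding one_enat_def by (intro Sup_upper) blast
  qed
qed

lemma cm_local_ring_dim1:
  "cm_local_ring_dim1 (semigroup_ring H :: 'k::field fps ring) (semigroup_max_ideal H)"
proof -
  have "(fps_X ^ Suc c :: 'k fps) \<in> semigroup_max_ideal H"
    unfolding semigroup_max_ideal_def by (auto intro!: subdegree_ge_carrier)
  moreover have "\<forall>y\<in>carrier (semigroup_ring H). fps_X ^ Suc c \<otimes>\<^bsub>semigroup_ring H\<^esub> y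
      = \<zero>\<^bsub>semigroup_ring H\<^esub> \<longrightarrow> y = (\<zero>\<^bsub>semigroup_ring H\<^esub> :: 'k fps)"
    by simp
  ultimately show ?thesis
    unfolding cm_local_ring_dim1_def using local_ring noetherian_ring krull_dim by blast
qed

end

lemma H511_ge: "n \<in> H511" if "n \<ge> 40"
proof -
  have "n mod 5 < 5" "8 \<le> n div 5" "n = 5 * (n div 5) + n mod 5" using that by auto
  then have "n = 5 * (n div 5 - 2 * (n mod 5)) + 11 * (n mod 5)" by linarith
  then show ?thesis unfolding H511_def by blast
qed

lemma H511_39: "39 \<notin> H511"
proof
  assume "39 \<in> H511"
  then obtain i j :: nat where ij: "39 = 5 * i + 11 * j" unfolding H511_def by blast
  then have "j \<le> 3" by simp
  then have "j = 0 \<or> j = 1 \<or> j = 2 \<or> j = 3" by linarith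
  then show False using ij by (elim disjE; presburger)
qed

interpretation H511: numerical_semigroup H511 40
proof
  show "0 \<in> H511" unfolding H511_def by auto
  show "i + j \<in> H511" if ij: "i \<in> H511" "j \<in> H511" for i j
  proof -
    obtain p q p' q' where "i = 5 * p + 11 * q" "j = 5 * p' + 11 * q'"
      using ij unfolding H511_def by blast
    then have "i + j = 5 * (p + p') + 11 * (q + q')" by simp
    then show ?thesis unfolding H511_def by blast
  qed
qed (rule H511_ge)

lemma conductor_H511: "conductor H511 = 40"
  unfolding conductor_def
proof (rule Least_equality)
  show "\<forall>n\<ge>40. n \<in> H511" using H511_ge by auto
next
  fix c assume "\<forall>n\<ge>c. n \<in> H511"
  then have "\<not> c \<le> 39" using H511_39 by blast
  then show "40 \<le> c" by simp
qed

lemma conductor_ideal_H511: "conductor_ideal H511 = t_power_ideal 40"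
proof (intro subset_antisym subsetI)
  fix f :: "'k::field fps" assume f: "f \<in> conductor_ideal H511"
  have "fps_nth f i = 0" if "i < 40" for i
  proof (rule ccontr)
    assume "fps_nth f i \<noteq> 0"
    then have nz: "f \<noteq> 0" and le: "subdegree f \<le> i" by (auto simp: subdegree_leI)
    have "f * fps_X ^ (39 - subdegree f) \<in> carrier A511"
      using f by (simp add: conductor_ideal_def)
    moreover have "fps_nth (f * fps_X ^ (39 - subdegree f)) 39 \<noteq> 0"
      using nz le that by (simp add: fps_X_power_mult_right_nth)
    ultimately show False using H511_39 by (simp add: H511.mem_carrier)
  qed
  then have "f = fps_X ^ 40 * fps_shift 40 f"
    by (intro fps_ext) (simp add: fps_X_power_mult_nth)
  then show "f \<in> t_power_ideal 40" unfolding t_power_ideal_def by blast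
next
  fix f :: "'k::field fps" assume "f \<in> t_power_ideal 40"
  then obtain v where "f = fps_X ^ 40 * v" unfolding t_power_ideal_def by blast
  then show "f \<in> conductor_ideal H511"
    unfolding conductor_ideal_def
    by (auto intro!: H511.subdegree_ge_carrier simp: mult.assoc fps_X_power_mult_nth)
qed

end

theory Submission
  imports Defs
begin

text \<open>
  Both normal forms arise in the same way. Let \<open>I = (f, g)\<close> with \<open>a < b\<close> the orders of \<open>f\<close> and \<open>g\<close>.
  As \<open>b - a\<close> is a gap of the semigroup, any two elements of \<open>I\<close> of orders \<open>a\<close> and \<open>b\<close> generate
  \<open>I\<close> (\<open>exchange_generators\<close>). One may therefore change \<open>f\<close> and \<open>g\<close> freely by elements of \<open>I\<close> of
  larger order, and clear the coefficient at every exponent that is the order of an element of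
  \<open>I\<close> (\<open>clear_coefficients\<close>). What remains are the larger exponents in \<open>H\<close>
  not known to be such orders.

  By (iv), all elements of \<open>H\<close> from \<open>40 - (b - a)\<close> on are orders of elements of \<open>I\<close>; so are the
  elements of \<open>a + H\<close> and \<open>b + H\<close>. For orders 10 and 27 this leaves 11, 16 and 22 in \<open>f\<close>, while
  \<open>t\<^bsup>27\<^esup>\<close> itself lies in \<open>I\<close>. The coefficient of \<open>t\<^bsup>11\<^esup>\<close> cannot vanish, since otherwise the two
  generators could not produce \<open>t\<^bsup>33\<^esup> \<in> I\<close>. For orders 20 and 26 one more order is needed:
  \<open>I\<^sup>2 = f I\<close> yields \<open>g\<^sup>2 / f \<in> I\<close>, of order 32. This element also gives \<open>t\<^bsup>32\<^esup> + \<epsilon> t\<^bsup>33\<^esup>\<close>.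
\<close>

section \<open>Ideals with two generators in a semigroup ring\<close>

context numerical_semigroup
begin

lemma fps_X_power_carrier: "(fps_X ^ n :: 'k::field fps) \<in> carrier (semigroup_ring H)" if "n \<in> H"
  using that by (simp add: mem_carrier fps_X_power_nth)

lemma subdegree_mem:
  fixes f :: "'k::field fps"
  assumes "f \<in> carrier (semigroup_ring H)" "f \<noteq> 0"
  shows "subdegree f \<in> H"
  using assms nth_subdegree_nonzero mem_carrier by blast

lemma ideal_diff:
  fixes J :: "'k::field fps set"
  assumes "ideal J (semigroup_ring H)" "x \<in> J" "y \<in> J"
  shows "x - y \<in> J"
proof -
  interpret J: ideal J "semigroup_ring H" by fact
  have "fps_const (- 1) * y \<in> J"
    using J.I_l_closed[OF assms(3) carrier_misc(3)] by simp
  from additive_subgroup.a_closed[OF J.is_additive_subgroup assms(2) this] show ?thesis by (simp flip: fps_const_neg)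
qed

lemma ideal_smult:
  fixes J :: "'k::field fps set"
  assumes "ideal J (semigroup_ring H)" "x \<in> J" "p \<in> carrier (semigroup_ring H)"
  shows "p * x \<in> J"
  using ideal.I_l_closed[OF assms] by simp

lemma mem_two_generated_ideal:
  fixes f g :: "'k::field fps"
  assumes "f \<in> carrier (semigroup_ring H)" "g \<in> carrier (semigroup_ring H)"
    and x: "x \<in> Idl\<^bsub>semigroup_ring H\<^esub> {f, g}"
  obtains p q where "p \<in> carrier (semigroup_ring H)" "q \<in> carrier (semigroup_ring H)"
    "x = p * f + q * g"
proof -
  interpret R: cring "semigroup_ring H :: 'k fps ring" by (rule cring)
  let ?S = "PIdl\<^bsub>semigroup_ring H\<^esub> f <+>\<^bsub>semigroup_ring H\<^esub> PIdl\<^bsub>semigroup_ring H\<^esub> g"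
  have S: "?S = {p * f + q * g | p q. p \<in> carrier (semigroup_ring H) \<and> q \<in> carrier (semigroup_ring H)}"
    by (auto simp: set_add_def' cgenideal_def)
  have "ideal ?S (semigroup_ring H)"
    using assms by (intro R.add_ideals R.cgenideal_ideal)
  moreover have "f = 1 * f + 0 * g" "g = 0 * f + 1 * g" by simp_all
  then have "{f, g} \<subseteq> ?S" unfolding S using carrier_misc(1,2) by blast
  ultimately have "x \<in> ?S" using R.genideal_minimal x by blast
  then show thesis using that unfolding S by blast
qed

text \<open>Write \<open>F = p f + q g\<close> and \<open>G = r f + s g\<close>. Comparing orders, \<open>p\<close> is a unit and \<open>r\<close> is not.
  If \<open>s\<close> were not a unit either, then \<open>r f\<close> would have the order of \<open>g\<close>, so the order of \<open>r\<close>
  would be the forbidden difference. Hence \<open>p s - q r\<close> is a unit, and Cramer's rule gives \<open>f\<close>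
  and \<open>g\<close> back.\<close>

lemma exchange_generators:
  fixes f g F G :: "'k::field fps"
  assumes carrier: "f \<in> carrier (semigroup_ring H)" "g \<in> carrier (semigroup_ring H)"
    and less: "subdegree f < subdegree g"
    and gap: "subdegree g - subdegree f \<notin> H"
    and F: "F \<in> Idl\<^bsub>semigroup_ring H\<^esub> {f, g}" "F \<noteq> 0" "subdegree F = subdegree f"
    and G: "G \<in> Idl\<^bsub>semigroup_ring H\<^esub> {f, g}" "G \<noteq> 0" "subdegree G = subdegree g"
  shows "Idl\<^bsub>semigroup_ring H\<^esub> {f, g} = Idl\<^bsub>semigroup_ring H\<^esub> {F, G}"
proof -
  interpret R: cring "semigroup_ring H :: 'k fps ring" by (rule cring)
  let ?I = "Idl\<^bsub>semigroup_ring H\<^esub> {f, g}" and ?J = "Idl\<^bsub>semigroup_ring H\<^esub> {F, G}"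
  let ?a = "subdegree f" and ?b = "subdegree g"
  obtain p q where p: "p \<in> carrier (semigroup_ring H)" and q: "q \<in> carrier (semigroup_ring H)"
    and Fpq: "F = p * f + q * g" by (rule mem_two_generated_ideal[OF carrier F(1)])
  obtain r s where r: "r \<in> carrier (semigroup_ring H)" and s: "s \<in> carrier (semigroup_ring H)"
    and Grs: "G = r * f + s * g" by (rule mem_two_generated_ideal[OF carrier G(1)])
  have I: "ideal ?I (semigroup_ring H)" using carrier by (intro R.genideal_ideal) auto
  have FGc: "F \<in> carrier (semigroup_ring H)" "G \<in> carrier (semigroup_ring H)"
    using ideal.Icarr[OF I] F(1) G(1) by auto
  have J: "ideal ?J (semigroup_ring H)" using FGc by (intro R.genideal_ideal) auto
  have FGJ: "F \<in> ?J" "G \<in> ?J" using R.genideal_self[of "{F, G}"] FGc by auto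
  have low: "fps_nth (u * f) ?a = fps_nth u 0 * fps_nth f ?a" "fps_nth (u * g) ?b = fps_nth u 0 * fps_nth g ?b"
    "n < ?b \<Longrightarrow> fps_nth (u * g) n = 0" for u n
    by (auto simp: fps_mult_nth_outside_subdegrees fps_mult_nth_conv_upto_subdegree_right)
  have "fps_nth F ?a \<noteq> 0" using F(2,3) by (metis nth_subdegree_nonzero)
  then have p0: "fps_nth p 0 \<noteq> 0" using less by (auto simp: Fpq low)
  have "fps_nth G ?a = 0" using G(3) less by (metis nth_less_subdegree_zero)
  moreover have "f \<noteq> 0" using F(2) Fpq p0 \<open>fps_nth F ?a \<noteq> 0\<close> less by (auto simp: low)
  ultimately have r0: "fps_nth r 0 = 0" using less by (auto simp: Grs low)
  have s0: "fps_nth s 0 \<noteq> 0"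
  proof
    assume s0: "fps_nth s 0 = 0"
    have Gb: "fps_nth G ?b \<noteq> 0" using G(2,3) by (metis nth_subdegree_nonzero)
    then have rfb: "fps_nth (r * f) ?b \<noteq> 0" by (simp add: Grs low s0)
    moreover have "fps_nth (r * f) n = 0" if "n < ?b" for n
    proof -
      have "fps_nth G n = 0" using that G(3) by (metis nth_less_subdegree_zero)
      then show ?thesis using that by (simp add: Grs low)
    qed
    ultimately have "subdegree (r * f) = ?b" by (intro subdegreeI) auto
    moreover have "r \<noteq> 0" using rfb by auto
    ultimately have "subdegree r = ?b - ?a" using \<open>f \<noteq> 0\<close> by simp
    then show False using subdegree_mem[OF r \<open>r \<noteq> 0\<close>] gap by simp
  qed
  define d where "d = p * s - q * r"
  have dc: "d \<in> carrier (semigroup_ring H)"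
    unfolding d_def using p q r s by (intro carrier_misc carrier_mult)
  have d0: "fps_nth d 0 \<noteq> 0" using p0 r0 s0 by (simp add: d_def)
  have dd: "inverse d * d = 1" using d0 by (rule inverse_mult_eq_1)
  have cramer: "d * f = s * F - q * G" "d * g = p * G - r * F"
    unfolding d_def Fpq Grs by (simp_all add: algebra_simps)
  have unit: "x \<in> ?J" if "d * x \<in> ?J" for x
  proof -
    have "inverse d * (d * x) \<in> ?J"
      by (rule ideal_smult[OF J that carrier_inverse[OF dc d0]])
    then show ?thesis using dd by (simp flip: mult.assoc)
  qed
  have "f \<in> ?J" "g \<in> ?J"
    by (rule unit, simp only: cramer, intro ideal_diff ideal_smult J FGJ p q r s)+
  then have "?I \<subseteq> ?J" by (intro R.genideal_minimal J) auto
  moreover have "?J \<subseteq> ?I" using F(1) G(1) by (intro R.genideal_minimal I) auto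
  ultimately show ?thesis by blast
qed

text \<open>Gaussian elimination on coefficients: subtracting multiples of elements of \<open>J\<close> of order
  \<open>k\<close>, for \<open>k\<close> in \<open>K\<close> in increasing order, never disturbs a coefficient already cleared.
  Finitely many steps suffice, because a nonzero \<open>J\<close> contains every series of large order.\<close>

lemma clear_coefficients:
  fixes J :: "'k::field fps set"
  assumes J: "ideal J (semigroup_ring H)" and x: "x \<in> J"
    and K: "\<And>k. k \<in> K \<Longrightarrow> m < k \<and> (\<exists>e\<in>J. e \<noteq> 0 \<and> subdegree e = k)"
  obtains y where "y \<in> J" "\<And>n. n \<le> m \<Longrightarrow> fps_nth y n = fps_nth x n"
    "\<And>n. n \<in> K \<Longrightarrow> fps_nth y n = 0"
proof (cases "x = 0")
  case True
  then show thesis using that x by auto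
next
  case False
  define N where "N = Suc m + (subdegree x + c)"
  have "\<exists>y\<in>J. (\<forall>n\<le>m. fps_nth y n = fps_nth x n) \<and> (\<forall>n\<in>K. n < d \<longrightarrow> fps_nth y n = 0)" for d
  proof (induction d)
    case 0
    then show ?case using x by auto
  next
    case (Suc d)
    then obtain y where y: "y \<in> J" "\<forall>n\<le>m. fps_nth y n = fps_nth x n"
      "\<forall>n\<in>K. n < d \<longrightarrow> fps_nth y n = 0" by blast
    show ?case
    proof (cases "d \<in> K")
      case False
      then show ?thesis using y by (auto simp: less_Suc_eq intro!: bexI[of _ y])
    next
      case True
      then obtain e where e: "m < d" "e \<in> J" "e \<noteq> 0" "subdegree e = d" using K by blast
      have en: "fps_nth e d \<noteq> 0" "\<And>n. n < d \<Longrightarrow> fps_nth e n = 0"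
        using e by auto
      let ?z = "y - fps_const (fps_nth y d / fps_nth e d) * e"
      have "?z \<in> J" by (intro ideal_diff[OF J] ideal_smult[OF J] y(1) e(2) carrier_misc)
      moreover have "fps_nth ?z n = fps_nth y n" if "n < d" for n using that en by simp
      moreover have "fps_nth ?z d = 0" using en by simp
      ultimately show ?thesis using y e(1)
        by (intro bexI[of _ ?z]) (auto simp only: less_Suc_eq le_less_trans)
    qed
  qed
  then obtain y where y: "y \<in> J" "\<forall>n\<le>m. fps_nth y n = fps_nth x n"
      "\<forall>n\<in>K. n < N \<longrightarrow> fps_nth y n = 0" by blast
  have "y - fps_cutoff N y \<in> J"
    by (rule ideal_contains_tail[OF J x False]) (simp add: N_def)
  from ideal_diff[OF J y(1) this] have "fps_cutoff N y \<in> J" by simp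
  then show thesis
    by (rule that) (use y in \<open>auto simp: N_def\<close>)
qed

lemma monic_multiple:
  fixes J :: "'k::field fps set"
  assumes J: "ideal J (semigroup_ring H)" and x: "x \<in> J" "x \<noteq> 0"
  obtains y where "y \<in> J" "fps_nth y (subdegree x) = 1" "\<And>n. n < subdegree x \<Longrightarrow> fps_nth y n = 0"
proof
  show "fps_const (inverse (fps_nth x (subdegree x))) * x \<in> J"
    by (intro ideal_smult[OF J x(1)] carrier_misc)
qed (use x in auto)

end


section \<open>The semigroup generated by 5 and 11\<close>

text \<open>As 11 is 1 modulo 5, the least element of the semigroup that is \<open>r\<close> modulo 5 is \<open>11 r\<close>.\<close>

lemma mem_H511_iff: "n \<in> H511 \<longleftrightarrow> 11 * (n mod 5) \<le> n"
proof
  assume "n \<in> H511"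
  then obtain i j where n: "n = 5 * i + 11 * j" unfolding H511_def by blast
  have "n = j + 5 * (i + 2 * j)" by (simp add: n)
  then have "n mod 5 = j mod 5" by (metis mod_mult_self2)
  then show "11 * (n mod 5) \<le> n" using n mod_less_eq_dividend[of j 5] by linarith
next
  assume "11 * (n mod 5) \<le> n"
  moreover have "n = 5 * (n div 5) + n mod 5" by simp
  ultimately have "n = 5 * (n div 5 - 2 * (n mod 5)) + 11 * (n mod 5)" by linarith
  then show "n \<in> H511" unfolding H511_def by blast
qed

lemma order_shift_511:
  fixes J :: "'k::field fps set"
  assumes J: "ideal J A511" and e: "e \<in> J" "e \<noteq> 0" and n: "subdegree e \<le> n" "n - subdegree e \<in> H511"
  shows "\<exists>e'\<in>J. e' \<noteq> 0 \<and> subdegree e' = n"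
proof
  show "fps_X ^ (n - subdegree e) * e \<in> J"
    by (rule H511.ideal_smult[OF J e(1) H511.fps_X_power_carrier[OF n(2)]])
qed (use e n in simp)

lemma fps_X_power_mem_t_power_ideal:
  assumes "N \<le> n" "n \<in> H511"
  shows "(fps_X ^ n :: 'k::field fps) \<in> t_power_ideal N \<inter> carrier A511"
proof -
  have "(fps_X ^ n :: 'k fps) = fps_X ^ N * fps_X ^ (n - N)"
    using assms(1) by (simp flip: power_add)
  then show ?thesis unfolding t_power_ideal_def
    using H511.fps_X_power_carrier[OF assms(2)] by blast
qed


section \<open>Orders 10 and 27\<close>

lemma normal_form_10_27:
  fixes I :: "'k::field fps set"
  assumes I: "I = Idl\<^bsub>A511\<^esub> {f, g}" and carrier: "f \<in> carrier A511" "g \<in> carrier A511"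
    and f: "f \<noteq> 0" "subdegree f = 10" and g: "subdegree g = 27"
    and tail: "t_power_ideal 23 \<inter> carrier A511 \<subseteq> I"
  shows "\<exists>\<alpha>\<^sub>1 \<alpha>\<^sub>2 \<alpha>\<^sub>3 :: 'k. \<alpha>\<^sub>1 \<noteq> 0 \<and>
        I = Idl\<^bsub>A511\<^esub>
          {fps_X ^ 10 + fps_const \<alpha>\<^sub>1 * fps_X ^ 11 + fps_const \<alpha>\<^sub>2 * fps_X ^ 16
             + fps_const \<alpha>\<^sub>3 * fps_X ^ 22,
           fps_X ^ 27}"
proof -
  interpret R: cring "A511 :: 'k fps ring" by (rule H511.cring)
  have idI: "ideal I A511" unfolding I using carrier by (intro R.genideal_ideal) auto
  have fI: "f \<in> I" unfolding I using R.genideal_self[of "{f, g}"] carrier by auto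
  have XI: "fps_X ^ n \<in> I" if "23 \<le> n" "n \<in> H511" for n
    using fps_X_power_mem_t_power_ideal[OF that] tail by blast
  obtain f1 where f1: "f1 \<in> I" "fps_nth f1 10 = 1" "\<And>n. n < 10 \<Longrightarrow> fps_nth f1 n = 0"
    using H511.monic_multiple[OF idI fI f(1)] unfolding f(2) by metis
  define K where "K = {15, 20, 21} \<union> {n \<in> H511. 23 \<le> n}"
  have K: "10 < k \<and> (\<exists>e\<in>I. e \<noteq> 0 \<and> subdegree e = k)" if "k \<in> K" for k
  proof (cases "23 \<le> k")
    case True
    then show ?thesis using that XI[of k] by (auto simp: K_def intro!: bexI[of _ "fps_X ^ k"])
  next
    case False
    then have "k \<in> {15, 20, 21}" using that by (auto simp: K_def)
    then have "10 < k" "k - 10 \<in> H511" by (auto simp: mem_H511_iff)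
    then show ?thesis using order_shift_511[OF idI fI f(1), of k] f(2) by simp
  qed
  obtain F where F: "F \<in> I" "\<And>n. n \<le> 10 \<Longrightarrow> fps_nth F n = fps_nth f1 n"
    "\<And>n. n \<in> K \<Longrightarrow> fps_nth F n = 0"
    using H511.clear_coefficients[OF idI f1(1) K] by metis
  have Fc: "F \<in> carrier A511" using ideal.Icarr[OF idI F(1)] .
  have F0: "fps_nth F n = 0" if "n \<notin> {10, 11, 16, 22}" for n
  proof (rule ccontr)
    assume nz: "fps_nth F n \<noteq> 0"
    then have H: "n \<in> H511" using Fc by (simp add: H511.mem_carrier)
    have "10 \<le> n" using nz F(2)[of n] f1(3)[of n] by (cases "n < 10") auto
    moreover have "n \<notin> K" using nz F(3) by blast
    ultimately have "n \<in> {10..<23}" "n \<notin> {15, 20, 21}" using H by (auto simp: K_def)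
    then show False using H that by (auto simp: mem_H511_iff simp flip: set_upt)
  qed
  have F10: "fps_nth F 10 = 1" using F(2)[of 10] f1(2) by simp
  have sF: "subdegree F = 10" using F10 F0 by (intro subdegreeI) auto
  have gen: "I = Idl\<^bsub>A511\<^esub> {F, fps_X ^ 27}"
    unfolding I
  proof (rule H511.exchange_generators[OF carrier])
    show "F \<in> Idl\<^bsub>A511\<^esub> {f, g}" "fps_X ^ 27 \<in> Idl\<^bsub>A511\<^esub> {f, g}"
      using F(1) XI[of 27] by (auto simp: I mem_H511_iff)
    show "F \<noteq> 0" using F10 by auto
  qed (simp_all add: f g sF mem_H511_iff)
  have form: "F = fps_X ^ 10 + fps_const (fps_nth F 11) * fps_X ^ 11
      + fps_const (fps_nth F 16) * fps_X ^ 16 + fps_const (fps_nth F 22) * fps_X ^ 22"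
    by (rule fps_ext) (use F0 F10 in \<open>auto simp: fps_X_power_nth\<close>)
  \<comment> \<open>Multiples of \<open>t\<^bsup>27\<^esup>\<close> have no term \<open>t\<^bsup>33\<^esup>\<close>, as 6 is a gap; so \<open>t\<^bsup>33\<^esup> \<in> I\<close> takes that
    term from a multiple \<open>p F\<close> of order at least 27. Then \<open>p\<close> has no term \<open>t\<^bsup>11\<^esup>\<close>, nor \<open>t\<^bsup>17\<^esup>\<close> and \<open>t\<^bsup>23\<^esup>\<close>
    because 17 and 23 are gaps. Only \<open>t\<^bsup>22\<^esup>\<close> in \<open>p\<close> times \<open>t\<^bsup>11\<^esup>\<close> in \<open>F\<close> remains.\<close>
  have "fps_nth F 11 \<noteq> 0"
  proof
    assume F11: "fps_nth F 11 = 0"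
    have X27: "fps_X ^ 27 \<in> carrier (A511 :: 'k fps ring)"
      by (rule H511.fps_X_power_carrier) (simp add: mem_H511_iff)
    have X33: "fps_X ^ 33 \<in> Idl\<^bsub>A511\<^esub> {F, fps_X ^ 27}" using XI[of 33] gen by (simp add: mem_H511_iff)
    obtain p q where p: "p \<in> carrier A511" and q: "q \<in> carrier A511"
      and pq: "fps_X ^ 33 = p * F + q * fps_X ^ 27"
      by (rule H511.mem_two_generated_ideal[OF Fc X27 X33])
    have low: "fps_nth (p * F) n = 0" if "n < 27" for n
    proof -
      have "p * F = fps_X ^ 33 - q * fps_X ^ 27" by (simp add: pq)
      then show ?thesis using that by (simp add: fps_X_power_nth fps_X_power_mult_right_nth)
    qed
    have p11: "fps_nth p 11 = 0"
    proof (cases "p = 0")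
      case False
      then have "p * F \<noteq> 0" using F10 by auto
      then have "\<not> subdegree (p * F) < 27" using low nth_subdegree_nonzero by blast
      then have "11 < subdegree p" using False F10 sF by (subst (asm) subdegree_mult) auto
      then show ?thesis by (rule nth_less_subdegree_zero)
    qed simp
    have gaps: "fps_nth p 17 = 0" "fps_nth p 23 = 0" "fps_nth q 6 = 0"
      using p q unfolding H511.mem_carrier mem_H511_iff by (auto dest!: spec)
    have "fps_nth (p * F) 33 = 0"
      by (subst form) (simp add: F11 distrib_left mult.left_commute[of p] fps_X_power_mult_right_nth p11 gaps)
    moreover have "fps_nth (fps_X ^ 33 :: 'k fps) 33 = 1" by simp
    ultimately show False unfolding pq by (simp add: fps_X_power_mult_right_nth gaps)
  qed
  then show ?thesis using gen form by metis
qed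


section \<open>Orders 20 and 26\<close>

text \<open>The relation \<open>I\<^sup>2 = f I\<close> gives \<open>g\<^sup>2 = f h\<close> with \<open>h\<close> in \<open>I\<close> of order \<open>2 \<cdot> 26 - 20 = 32\<close>. The orders of
  elements of \<open>I\<close> thus contain, besides 25, 30 and 31, also 32, which clears these coefficients.\<close>

lemma normal_form_20_26:
  fixes I :: "'k::field fps set"
  assumes I: "I = Idl\<^bsub>A511\<^esub> {f, g}" and carrier: "f \<in> carrier A511" "g \<in> carrier A511"
    and f: "f \<noteq> 0" "subdegree f = 20" and g: "g \<noteq> 0" "subdegree g = 26"
    and sq: "ideal_prod A511 I I = f <#\<^bsub>A511\<^esub> I"
    and tail: "t_power_ideal 34 \<inter> carrier A511 \<subseteq> I"
  shows "\<exists>\<alpha>\<^sub>1 \<alpha>\<^sub>2 \<alpha>\<^sub>3 \<alpha>\<^sub>4 \<beta>\<^sub>1 \<beta>\<^sub>2 \<epsilon> :: 'k.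
        I = Idl\<^bsub>A511\<^esub>
          {fps_X ^ 20 + fps_const \<alpha>\<^sub>1 * fps_X ^ 21 + fps_const \<alpha>\<^sub>2 * fps_X ^ 22
             + fps_const \<alpha>\<^sub>3 * fps_X ^ 27 + fps_const \<alpha>\<^sub>4 * fps_X ^ 33,
           fps_X ^ 26 + fps_const \<beta>\<^sub>1 * fps_X ^ 27 + fps_const \<beta>\<^sub>2 * fps_X ^ 33} \<and>
        fps_X ^ 32 + fps_const \<epsilon> * fps_X ^ 33 \<in> I"
proof -
  interpret R: cring "A511 :: 'k fps ring" by (rule H511.cring)
  have idI: "ideal I A511" unfolding I using carrier by (intro R.genideal_ideal) auto
  have fI: "f \<in> I" and gI: "g \<in> I" unfolding I using R.genideal_self[of "{f, g}"] carrier by auto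
  have "g * g \<in> f <#\<^bsub>A511\<^esub> I" using ideal_prod.prod[OF gI gI, of A511] by (simp flip: sq)
  then obtain h where h: "h \<in> I" "g * g = f * h" by (auto simp: l_coset_def)
  have h0: "h \<noteq> 0" using h(2) g(1) by auto
  have "subdegree (f * h) = 52" using g by (simp flip: h(2))
  then have sh: "subdegree h = 32" using f h0 by simp
  define K where "K = {25, 26, 30, 31, 32} \<union> {n \<in> H511. 34 \<le> n}"
  have K: "\<exists>e\<in>I. e \<noteq> 0 \<and> subdegree e = k" if k: "k \<in> K" for k
  proof (cases "34 \<le> k")
    case True
    then have "fps_X ^ k \<in> I"
      using k fps_X_power_mem_t_power_ideal[OF True] tail by (auto simp: K_def)
    then show ?thesis by (auto intro!: bexI[of _ "fps_X ^ k"])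
  next
    case False
    then consider "k \<in> {25, 30, 31}" | "k = 26" | "k = 32" using k by (auto simp: K_def)
    then show ?thesis
    proof cases
      case 1
      then have "20 \<le> k" "k - 20 \<in> H511" by (auto simp: mem_H511_iff)
      then show ?thesis using order_shift_511[OF idI fI f(1), of k] f(2) by simp
    qed (use gI g h(1) h0 sh in auto)
  qed
  have reduce: "\<exists>y\<in>I. y \<noteq> 0 \<and> subdegree y = subdegree x \<and> fps_nth y (subdegree x) = 1 \<and>
      (\<forall>n. fps_nth y n \<noteq> 0 \<longrightarrow> subdegree x \<le> n \<and> (n = subdegree x \<or> n \<in> {21, 22, 27, 33}))"
    if x: "x \<in> I" "x \<noteq> 0" "20 \<le> subdegree x" for x
  proof -
    obtain x1 where x1: "x1 \<in> I" "fps_nth x1 (subdegree x) = 1"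
        "\<And>n. n < subdegree x \<Longrightarrow> fps_nth x1 n = 0"
      using H511.monic_multiple[OF idI x(1,2)] by metis
    obtain y where y: "y \<in> I" "\<And>n. n \<le> subdegree x \<Longrightarrow> fps_nth y n = fps_nth x1 n"
      "\<And>n. n \<in> K \<inter> {subdegree x<..} \<Longrightarrow> fps_nth y n = 0"
      using H511.clear_coefficients[OF idI x1(1), of "K \<inter> {subdegree x<..}" "subdegree x"] K
      by (metis IntD1 IntD2 greaterThan_iff)
    have lead: "fps_nth y (subdegree x) = 1" using y(2) x1(2) by simp
    have low: "fps_nth y n = 0" if "n < subdegree x" for n using that y(2)[of n] x1(3) by simp
    have "n = subdegree x \<or> n \<in> {21, 22, 27, 33}" if nz: "fps_nth y n \<noteq> 0" for n
    proof (rule disjCI)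
      assume out: "n \<notin> {21, 22, 27, 33}"
      have H: "n \<in> H511" using nz ideal.Icarr[OF idI y(1)] by (simp add: H511.mem_carrier)
      show "n = subdegree x"
      proof (rule ccontr)
        assume "n \<noteq> subdegree x"
        then have gt: "subdegree x < n" using low nz by (meson linorder_neqE_nat)
        then have "n \<notin> K" using y(3) nz by auto
        then have "n \<in> {21..<34}" "n \<notin> {25, 26, 30, 31, 32}"
          using H gt x(3) by (auto simp: K_def)
        then show False using H out by (auto simp: mem_H511_iff simp flip: set_upt)
      qed
    qed
    then show ?thesis using y(1) lead low
      by (intro bexI[of _ y]) (auto intro!: subdegreeI simp: not_less[symmetric])
  qed
  obtain F where F: "F \<in> I" "F \<noteq> 0" "subdegree F = 20" "fps_nth F 20 = 1"
      "\<And>n. n \<notin> {20, 21, 22, 27, 33} \<Longrightarrow> fps_nth F n = 0"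
    using reduce[OF fI f(1)] unfolding f(2) by auto
  obtain G where G: "G \<in> I" "G \<noteq> 0" "subdegree G = 26" "fps_nth G 26 = 1"
      "\<And>n. n \<notin> {26, 27, 33} \<Longrightarrow> fps_nth G n = 0"
    using reduce[OF gI g(1)] unfolding g(2) by (auto; fastforce)
  obtain E where E: "E \<in> I" "fps_nth E 32 = 1" "\<And>n. n \<notin> {32, 33} \<Longrightarrow> fps_nth E n = 0"
    using reduce[OF h(1) h0] unfolding sh by (auto; fastforce)
  have gen: "I = Idl\<^bsub>A511\<^esub> {F, G}"
    unfolding I
    by (rule H511.exchange_generators[OF carrier])
      (use F(1-3) G(1-3) in \<open>simp_all add: f g I[symmetric] mem_H511_iff\<close>)
  have "F = fps_X ^ 20 + fps_const (fps_nth F 21) * fps_X ^ 21 + fps_const (fps_nth F 22) * fps_X ^ 22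
      + fps_const (fps_nth F 27) * fps_X ^ 27 + fps_const (fps_nth F 33) * fps_X ^ 33"
    by (rule fps_ext) (use F(4,5) in \<open>auto simp: fps_X_power_nth\<close>)
  moreover have "G = fps_X ^ 26 + fps_const (fps_nth G 27) * fps_X ^ 27
      + fps_const (fps_nth G 33) * fps_X ^ 33"
    by (rule fps_ext) (use G(4,5) in \<open>auto simp: fps_X_power_nth\<close>)
  moreover have "E = fps_X ^ 32 + fps_const (fps_nth E 33) * fps_X ^ 33"
    by (rule fps_ext) (use E(2,3) in \<open>auto simp: fps_X_power_nth\<close>)
  ultimately show ?thesis using gen E(1) by metis
qed


section \<open>The two normal forms\<close>

theorem proposition4p2:
  fixes I :: "'k::field fps set" and f g :: "'k fps" and a b c :: nat
  assumes "ulrich_ideal A511 m511 I"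
    and "f \<in> I" and "g \<in> I"
    and "a = subdegree f" and "b = subdegree g" and "c = conductor H511"
    \<comment> \<open>(i)\<close>
    and "I = Idl\<^bsub>A511\<^esub> {f, g}" and "ideal_prod A511 I I = f <#\<^bsub>A511\<^esub> I"
    \<comment> \<open>(ii)\<close>
    and "a \<in> H511" and "b \<in> H511" and "0 < a" and "a < b" and "b < a + c"
    \<comment> \<open>(iii)\<close>
    and "b - a \<notin> H511" and "2 * b - a \<in> H511"
    and "enat a = 2 * module_length A511 (residue_module A511 I)"
    \<comment> \<open>(iv)\<close>
    and "t_power_ideal (c - (b - a)) \<inter> carrier A511 \<subseteq> I" and "conductor_ideal H511 \<subseteq> I"
    \<comment> \<open>(v)\<close>
    and "a \<ge> c \<longrightarrow> multiplicity_dim1 (A511 :: 'k fps ring) m511 = 2 \<and> I = conductor_ideal H511"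
  shows "((a, b) = (10, 27) \<longrightarrow>
      (\<exists>\<alpha>\<^sub>1 \<alpha>\<^sub>2 \<alpha>\<^sub>3 :: 'k. \<alpha>\<^sub>1 \<noteq> 0 \<and>
        I = Idl\<^bsub>A511\<^esub>
          {fps_X ^ 10 + fps_const \<alpha>\<^sub>1 * fps_X ^ 11 + fps_const \<alpha>\<^sub>2 * fps_X ^ 16
             + fps_const \<alpha>\<^sub>3 * fps_X ^ 22,
           fps_X ^ 27})) \<and>
    ((a, b) = (20, 26) \<longrightarrow>
      (\<exists>\<alpha>\<^sub>1 \<alpha>\<^sub>2 \<alpha>\<^sub>3 \<alpha>\<^sub>4 \<beta>\<^sub>1 \<beta>\<^sub>2 \<epsilon> :: 'k.
        I = Idl\<^bsub>A511\<^esub>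
          {fps_X ^ 20 + fps_const \<alpha>\<^sub>1 * fps_X ^ 21 + fps_const \<alpha>\<^sub>2 * fps_X ^ 22
             + fps_const \<alpha>\<^sub>3 * fps_X ^ 27 + fps_const \<alpha>\<^sub>4 * fps_X ^ 33,
           fps_X ^ 26 + fps_const \<beta>\<^sub>1 * fps_X ^ 27 + fps_const \<beta>\<^sub>2 * fps_X ^ 33} \<and>
        fps_X ^ 32 + fps_const \<epsilon> * fps_X ^ 33 \<in> I))"
proof -
  interpret R: cring "A511 :: 'k fps ring" by (rule H511.cring)
  have "primary_ideal A511 I" using assms(1) by (simp add: ulrich_ideal_def primary_to_def)
  then interpret I: ideal I A511 by (simp add: primary_ideal_def)
  have carrier: "f \<in> carrier A511" "g \<in> carrier A511"
    using assms(2,3) I.Icarr by blast+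
  \<comment> \<open>The zero series has order 0 by convention, so positive orders mean nonzero series.\<close>
  have nz: "f \<noteq> 0" "g \<noteq> 0" using assms(4,5) \<open>0 < a\<close> \<open>a < b\<close> by auto
  have c: "c = 40" using assms(6) conductor_H511 by simp
  have tail: "t_power_ideal (40 - (b - a)) \<inter> carrier A511 \<subseteq> I"
    using \<open>t_power_ideal (c - (b - a)) \<inter> carrier A511 \<subseteq> I\<close> by (simp add: c)
  show ?thesis
  proof (intro conjI impI)
    assume "(a, b) = (10, 27)"
    then show "\<exists>\<alpha>\<^sub>1 \<alpha>\<^sub>2 \<alpha>\<^sub>3 :: 'k. \<alpha>\<^sub>1 \<noteq> 0 \<and>
        I = Idl\<^bsub>A511\<^esub>
          {fps_X ^ 10 + fps_const \<alpha>\<^sub>1 * fps_X ^ 11 + fps_const \<alpha>\<^sub>2 * fps_X ^ 16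
             + fps_const \<alpha>\<^sub>3 * fps_X ^ 22,
           fps_X ^ 27}"
      using tail assms(4,5)
      by (intro normal_form_10_27[OF assms(7) carrier nz(1)]) simp_all
  next
    assume "(a, b) = (20, 26)"
    then show "\<exists>\<alpha>\<^sub>1 \<alpha>\<^sub>2 \<alpha>\<^sub>3 \<alpha>\<^sub>4 \<beta>\<^sub>1 \<beta>\<^sub>2 \<epsilon> :: 'k.
        I = Idl\<^bsub>A511\<^esub>
          {fps_X ^ 20 + fps_const \<alpha>\<^sub>1 * fps_X ^ 21 + fps_const \<alpha>\<^sub>2 * fps_X ^ 22
             + fps_const \<alpha>\<^sub>3 * fps_X ^ 27 + fps_const \<alpha>\<^sub>4 * fps_X ^ 33,
           fps_X ^ 26 + fps_const \<beta>\<^sub>1 * fps_X ^ 27 + fps_const \<beta>\<^sub>2 * fps_X ^ 33} \<and>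
        fps_X ^ 32 + fps_const \<epsilon> * fps_X ^ 33 \<in> I"
      using tail assms(4,5)
      by (intro normal_form_20_26[OF assms(7) carrier nz(1) _ nz(2) _ assms(8)]) simp_all
  qed
qed

end
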